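(* Let $\mathcal{D}$ be a non-empty set of bounded random variables, let $\underline{P}:\mathcal{D}\to\mathbb{R}$ be bi-coherent, and let $\mathcal{L}$ be any linear space of bounded random variables containing $\mathcal{D}$. Then there exists a bi-coherent extension of $\underline{P}$ to $\mathcal{L}$ (a bi-coherent map $\mathcal{L}\to\mathbb{R}$ whose restriction to $\mathcal{D}$ is $\underline{P}$) if and only if $\underline{P}$ is dF-coherent on $\mathcal{D}$.
   Context: Bounded random variables are bounded real-valued functions on a common non-empty set of atoms; $\sup$ is the supremum over all atoms. A map $\underline{P}:\mathcal{D}\to\mathbb{R}$ is a bi-coherent lower prevision on $\mathcal{D}$ iff for all integers $n\ge 0$, all $X_1,\dots,X_n,Y_1,Y_2\in\mathcal{D}$ and all real $s_1,\dots,s_n,r_1,r_2\ge 0$, putting $G=\sum_{i=1}^n s_i(X_i-\underline{P}(X_i))-r_1(Y_1-\underline{P}(Y_1))-r_2(Y_2-\underline{P}(Y_2))$, one has $\sup G\ge 0$. A map $P:\mathcal{D}\to\mathbb{R}$ is dF-coherent (a dF-coherent precise prevision) on $\mathcal{D}$ iff for all integers $n,m\ge 0$, all $X_1,\dots,X_n,Y_1,\dots,Y_m\in\mathcal{D}$ and all real $s_1,\dots,s_n\ge 0$, $r_1,\dots,r_m\ge 0$, putting $G=\sum_{i=1}^n s_i(X_i-P(X_i))-\sum_{j=1}^m r_j(Y_j-P(Y_j))$, one has $\sup G\ge 0$. *)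

theory Defs
  imports "HOL-Analysis.Analysis" "HOL-Library.Function_Algebras"
begin

text \<open>
  The set of atoms is the type \<open>'w\<close>, which is non-empty like every HOL type.
  Addition and zero on random variables are the pointwise operations of
  \<^theory>\<open>HOL-Library.Function_Algebras\<close>; together with pointwise scaling they form a real
  vector space, which yields the notion \<open>rv.subspace\<close> of a linear space of random variables.
\<close>

definition scale_rv :: "real \<Rightarrow> ('w \<Rightarrow> real) \<Rightarrow> 'w \<Rightarrow> real"
  where "scale_rv c X = (\<lambda>w. c * X w)"

global_interpretation rv: vector_space "scale_rv :: real \<Rightarrow> ('w \<Rightarrow> real) \<Rightarrow> 'w \<Rightarrow> real"
  by unfold_locales (simp_all add: scale_rv_def plus_fun_def fun_eq_iff algebra_simps)

definition bounded_rvs :: "('w \<Rightarrow> real) set"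
  where "bounded_rvs = {X. bounded (range X)}"

text \<open>
  A map on \<open>D\<close> is represented by a total function on random variables whose values outside \<open>D\<close>
  are irrelevant. The two notions below are meant for \<open>D \<subseteq> bounded_rvs\<close>, where every gain is a
  bounded function, so that the real-valued supremum is the genuine one. The finite families
  are indexed from 0, and empty families are allowed.
\<close>

definition bi_coherent :: "('w \<Rightarrow> real) set \<Rightarrow> (('w \<Rightarrow> real) \<Rightarrow> real) \<Rightarrow> bool"
  where "bi_coherent D P \<longleftrightarrow>
    (\<forall>(n::nat) (X :: nat \<Rightarrow> 'w \<Rightarrow> real) (s :: nat \<Rightarrow> real) Y1 Y2 (r1::real) (r2::real).
      (\<forall>i<n. X i \<in> D \<and> s i \<ge> 0) \<and> Y1 \<in> D \<and> Y2 \<in> D \<and> r1 \<ge> 0 \<and> r2 \<ge> 0 \<longrightarrow>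
      (SUP w. (\<Sum>i<n. s i * (X i w - P (X i))) - r1 * (Y1 w - P Y1) - r2 * (Y2 w - P Y2)) \<ge> 0)"

definition dF_coherent :: "('w \<Rightarrow> real) set \<Rightarrow> (('w \<Rightarrow> real) \<Rightarrow> real) \<Rightarrow> bool"
  where "dF_coherent D P \<longleftrightarrow>
    (\<forall>(n::nat) (m::nat) (X :: nat \<Rightarrow> 'w \<Rightarrow> real) (Y :: nat \<Rightarrow> 'w \<Rightarrow> real)
      (s :: nat \<Rightarrow> real) (r :: nat \<Rightarrow> real).
      (\<forall>i<n. X i \<in> D \<and> s i \<ge> 0) \<and> (\<forall>j<m. Y j \<in> D \<and> r j \<ge> 0) \<longrightarrow>
      (SUP w. (\<Sum>i<n. s i * (X i w - P (X i))) - (\<Sum>j<m. r j * (Y j w - P (Y j)))) \<ge> 0)"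

end

theory Submission
  imports Defs
begin

text \<open>
  Over a linear space the two notions of coherence agree. If \<open>Q\<close> is bi-coherent on a linear space,
  then a gain of the shape \<open>(Z - Q Z) - (X - Q X) - (Y - Q Y)\<close> with \<open>Z = X + Y\<close> and its
  opposite are both admissible, and both are constant; their signs force \<open>Q\<close> to be additive. Two
  subtracted terms are exactly what this argument needs. Homogeneity is obtained in the same way,
  so every dF-gain over the space collapses to a single term \<open>Z - Q Z\<close>, whose supremum
  bi-coherence controls. Restricting to \<open>D\<close> gives one implication
  (\<open>bi_coherent_imp_dF_coherent\<close>).

  For the converse, the gains of a dF-coherent \<open>P\<close> over \<open>D\<close> form a linear space \<open>V\<close> in which no
  element has negative supremum (\<open>dF_coherent_iff_span\<close>). Hence
  \<open>p Z = inf {sup (Z - G) | G \<in> V}\<close>, the natural upper extension of \<open>P\<close>, is a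
  finite sublinear functional below \<open>sup\<close> with \<open>p X \<le> P X\<close> and \<open>p (- X) \<le> - P X\<close> on \<open>D\<close>. The
  Hahn--Banach theorem, in the form that a sublinear functional dominates an additive one, gives a
  linear \<open>Q \<le> p\<close>. It agrees with \<open>P\<close> on \<open>D\<close> and lies below \<open>sup\<close>, so it is a dF-coherent extension
  (\<open>dF_coherent_extension\<close>), and a dF-coherent map is bi-coherent.

  The Hahn--Banach theorem is proved by taking a minimal sublinear functional below \<open>p\<close> and showing
  that minimality forces additivity. The sublinear functionals that occur, including \<open>p\<close> itself, are
  infima of families stable under addition and scaling, so one criterion
  (\<open>sublinear_on_INF\<close>) covers them all.
\<close>


section \<open>Minimal sublinear functionals\<close>

locale real_space = vector_space scale
  for scale :: "real \<Rightarrow> 'b::ab_group_add \<Rightarrow> 'b"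
begin

definition sublinear_on :: "'b set \<Rightarrow> ('b \<Rightarrow> real) \<Rightarrow> bool" where
  "sublinear_on S q \<longleftrightarrow>
     (\<forall>x\<in>S. \<forall>y\<in>S. q (x + y) \<le> q x + q y) \<and> (\<forall>x\<in>S. \<forall>c\<ge>0. q (scale c x) = c * q x)"

lemma sublinear_onD:
  assumes "sublinear_on S q"
  shows "\<And>x y. x \<in> S \<Longrightarrow> y \<in> S \<Longrightarrow> q (x + y) \<le> q x + q y"
    and "\<And>x c. x \<in> S \<Longrightarrow> 0 \<le> c \<Longrightarrow> q (scale c x) = c * q x"
  using assms by (auto simp: sublinear_on_def)

text \<open>
  The reverse inequality for a factor \<open>c > 0\<close> is the given one for \<open>1 / c\<close>; the factors \<open>2\<close> and
  \<open>1 / 2\<close> pin down the value at the origin.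
\<close>

lemma sublinear_onI:
  assumes S: "subspace S"
    and add: "\<And>x y. x \<in> S \<Longrightarrow> y \<in> S \<Longrightarrow> q (x + y) \<le> q x + q y"
    and scale: "\<And>x c. x \<in> S \<Longrightarrow> 0 < c \<Longrightarrow> q (scale c x) \<le> c * q x"
  shows "sublinear_on S q"
  unfolding sublinear_on_def
proof (intro conjI ballI allI impI)
  fix x y assume "x \<in> S" "y \<in> S"
  then show "q (x + y) \<le> q x + q y" by (rule add)
next
  fix x and c :: real assume x: "x \<in> S" and c: "0 \<le> c"
  have zero: "q 0 = 0"
    using scale[of 0 2] scale[of 0 "1/2"] subspace_0[OF S] by simp
  show "q (scale c x) = c * q x"
  proof (cases "c = 0")
    case True
    then show ?thesis by (simp add: zero)
  next
    case False
    with c have c: "c > 0" by simp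
    have "q x = q (scale (1 / c) (scale c x))" using c by simp
    also have "\<dots> \<le> (1 / c) * q (scale c x)"
      using c x by (intro scale subspace_scale[OF S]) auto
    finally have "c * q x \<le> q (scale c x)" using c by (simp add: field_simps)
    with scale[OF x c] show ?thesis by simp
  qed
qed

lemma sublinear_on_zero:
  assumes "subspace S" "sublinear_on S q"
  shows "q 0 = 0"
  using sublinear_onD(2)[OF assms(2) subspace_0[OF assms(1)], of 0] by simp

lemma sublinear_on_ge_neg:
  assumes "subspace S" "sublinear_on S q" "x \<in> S"
  shows "- q (- x) \<le> q x"
  using sublinear_onD(1)[OF assms(2,3) subspace_neg[OF assms(1,3)]] sublinear_on_zero[OF assms(1,2)]
  by simp

text \<open>
  An infimum of functionals that are not sublinear themselves is sublinear as soon as the family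
  absorbs sums and positive multiples: values at \<open>x\<close> and \<open>y\<close> that are close to the two infima are
  then combined into one value at \<open>x + y\<close>.
\<close>

lemma sublinear_on_INF:
  fixes f :: "'i \<Rightarrow> 'b \<Rightarrow> real"
  assumes S: "subspace S" and I: "I \<noteq> {}"
    and bdd: "\<And>x. x \<in> S \<Longrightarrow> bdd_below ((\<lambda>i. f i x) ` I)"
    and add: "\<And>i j x y. i \<in> I \<Longrightarrow> j \<in> I \<Longrightarrow> x \<in> S \<Longrightarrow> y \<in> S \<Longrightarrow>
               \<exists>k\<in>I. f k (x + y) \<le> f i x + f j y"
    and scale: "\<And>i x c. i \<in> I \<Longrightarrow> x \<in> S \<Longrightarrow> 0 < c \<Longrightarrow> \<exists>k\<in>I. f k (scale c x) \<le> c * f i x"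
  shows "sublinear_on S (\<lambda>x. INF i\<in>I. f i x)"
proof (rule sublinear_onI[OF S])
  fix x y assume x: "x \<in> S" and y: "y \<in> S"
  let ?m = "INF i\<in>I. f i (x + y)"
  have "?m - f i x \<le> f j y" if "i \<in> I" "j \<in> I" for i j
  proof -
    have "?m \<le> f i x + f j y"
      using add[OF that x y] cINF_lower2[OF bdd[OF subspace_add[OF S x y]]] by blast
    then show ?thesis by simp
  qed
  then have "?m - f i x \<le> (INF j\<in>I. f j y)" if "i \<in> I" for i
    using that I by (intro cINF_greatest)
  then have "?m - (INF j\<in>I. f j y) \<le> f i x" if "i \<in> I" for i
    using that by (metis diff_le_eq add.commute)
  then have "?m - (INF j\<in>I. f j y) \<le> (INF i\<in>I. f i x)"
    using I by (intro cINF_greatest)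
  then show "?m \<le> (INF i\<in>I. f i x) + (INF j\<in>I. f j y)" by simp
next
  fix x and c :: real assume x: "x \<in> S" and c: "0 < c"
  let ?m = "INF i\<in>I. f i (scale c x)"
  have "?m \<le> c * f i x" if "i \<in> I" for i
    using scale[OF that x c] cINF_lower2[OF bdd[OF subspace_scale[OF S x]]] by blast
  then have "?m / c \<le> (INF i\<in>I. f i x)"
    using I c by (intro cINF_greatest) (auto simp: field_simps)
  then show "?m \<le> c * (INF i\<in>I. f i x)" using c by (simp add: field_simps)
qed

text \<open>
  Zorn's lemma with the reversed pointwise order; the infimum of a chain is its bound. All
  functionals in the chain are bounded below at \<open>x\<close> by \<open>- p (- x)\<close>. Prescribing the value \<open>0\<close>
  outside \<open>S\<close> makes the order antisymmetric.
\<close>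

lemma minimal_sublinear_exists:
  assumes S: "subspace S" and p: "sublinear_on S p"
  obtains q where "sublinear_on S q" "\<And>x. x \<in> S \<Longrightarrow> q x \<le> p x"
    "\<And>r x. sublinear_on S r \<Longrightarrow> (\<And>y. y \<in> S \<Longrightarrow> r y \<le> q y) \<Longrightarrow> x \<in> S \<Longrightarrow> r x = q x"
proof -
  define A where "A = {q. sublinear_on S q \<and> (\<forall>x\<in>S. q x \<le> p x) \<and> (\<forall>x. x \<notin> S \<longrightarrow> q x = 0)}"
  define zero_off where "zero_off q = (\<lambda>x. if x \<in> S then q x else 0)" for q :: "'b \<Rightarrow> real"
  have zero_off_in: "zero_off q \<in> A" if "sublinear_on S q" "\<And>x. x \<in> S \<Longrightarrow> q x \<le> p x" for q
    using that S by (auto simp: A_def zero_off_def sublinear_on_def subspace_add subspace_scale)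
  have "\<exists>m\<in>A. \<forall>a\<in>A. a \<le> m \<longrightarrow> a = m"
  proof (rule predicate_Zorn[where P = "\<lambda>a b. b \<le> a"])
    show "partial_order_on A (relation_of (\<lambda>a b. b \<le> a) A)"
      by (rule partial_order_on_relation_ofI) auto
  next
    fix C assume C: "C \<in> Chains (relation_of (\<lambda>a b. b \<le> a) A)"
    then have sub: "C \<subseteq> A" and chain: "\<And>a b. a \<in> C \<Longrightarrow> b \<in> C \<Longrightarrow> a \<le> b \<or> b \<le> a"
      by (auto simp: Chains_def relation_of_def)
    show "\<exists>u\<in>A. \<forall>a\<in>C. u \<le> a"
    proof (cases "C = {}")
      case True
      then show ?thesis using zero_off_in[OF p] by auto
    next
      case False
      let ?u = "\<lambda>x. INF q\<in>C. q x"
      have bdd: "bdd_below ((\<lambda>q. q x) ` C)" if x: "x \<in> S" for x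
      proof (rule bdd_belowI2)
        fix q assume "q \<in> C"
        then have q: "sublinear_on S q" "\<And>x. x \<in> S \<Longrightarrow> q x \<le> p x"
          using sub by (auto simp: A_def)
        show "- p (- x) \<le> q x"
          using sublinear_on_ge_neg[OF S q(1) x] q(2)[OF subspace_neg[OF S x]] by simp
      qed
      have "sublinear_on S ?u"
      proof (rule sublinear_on_INF[OF S False bdd])
        fix i j :: "'b \<Rightarrow> real" and x y
        assume ij: "i \<in> C" "j \<in> C" and xy: "x \<in> S" "y \<in> S"
        obtain k where "k \<in> C" "k \<le> i" "k \<le> j" using chain[OF ij] ij by blast
        then have "k (x + y) \<le> k x + k y" "k x \<le> i x" "k y \<le> j y"
          using sub xy sublinear_onD(1)[of S k x y] by (auto simp: A_def le_fun_def)
        with \<open>k \<in> C\<close> show "\<exists>k\<in>C. k (x + y) \<le> i x + j y"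
          by (intro bexI[of _ k]) auto
      next
        fix i :: "'b \<Rightarrow> real" and x and c :: real
        assume "i \<in> C" "x \<in> S" "0 < c"
        then show "\<exists>k\<in>C. k (scale c x) \<le> c * i x"
          using sub sublinear_onD(2)[of S i x c] by (intro bexI[of _ i]) (auto simp: A_def)
      qed
      moreover have lower: "?u x \<le> q x" if "x \<in> S" "q \<in> C" for x q
        using bdd that by (intro cINF_lower)
      moreover have "?u x \<le> p x" if "x \<in> S" for x
      proof -
        obtain q where "q \<in> C" using False by blast
        then show ?thesis using lower[OF that] sub that by (fastforce simp: A_def)
      qed
      ultimately have "zero_off ?u \<in> A" by (intro zero_off_in)
      moreover have "zero_off ?u \<le> q" if "q \<in> C" for q
        using lower that sub by (auto simp: le_fun_def zero_off_def A_def)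
      ultimately show ?thesis by blast
    qed
  qed
  then obtain m where m: "m \<in> A" and min: "\<And>a. a \<in> A \<Longrightarrow> a \<le> m \<Longrightarrow> a = m" by blast
  show ?thesis
  proof (rule that[of m])
    show "sublinear_on S m" "\<And>x. x \<in> S \<Longrightarrow> m x \<le> p x" using m by (auto simp: A_def)
  next
    fix r x
    assume r: "sublinear_on S r" "\<And>y. y \<in> S \<Longrightarrow> r y \<le> m y" and x: "x \<in> S"
    have "zero_off r = m"
    proof (rule min)
      show "zero_off r \<in> A"
        using m r(2) by (intro zero_off_in r(1)) (fastforce simp: A_def)
      show "zero_off r \<le> m"
        using m r(2) by (auto simp: A_def le_fun_def zero_off_def)
    qed
    then show "r x = m x" using x by (metis zero_off_def)
  qed
qed

text \<open>
  For a minimal \<open>q\<close> and a direction \<open>z\<close>, the functional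
  \<open>r x = inf {q (x + t z) - t q z | t \<ge> 0}\<close> is sublinear and at most \<open>q\<close> (take \<open>t = 0\<close>). It must
  therefore be \<open>q\<close>, and then \<open>t = 1\<close> shows that \<open>q\<close> is also superadditive.
\<close>

theorem sublinear_dominates_additive:
  assumes S: "subspace S" and p: "sublinear_on S p"
  obtains q where "sublinear_on S q" "\<And>x. x \<in> S \<Longrightarrow> q x \<le> p x"
    "\<And>x y. x \<in> S \<Longrightarrow> y \<in> S \<Longrightarrow> q (x + y) = q x + q y"
proof -
  obtain q where q: "sublinear_on S q" and le: "\<And>x. x \<in> S \<Longrightarrow> q x \<le> p x"
    and min: "\<And>r x. sublinear_on S r \<Longrightarrow> (\<And>y. y \<in> S \<Longrightarrow> r y \<le> q y) \<Longrightarrow> x \<in> S \<Longrightarrow> r x = q x"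
    using minimal_sublinear_exists[OF S p] by metis
  have super: "q x + q z \<le> q (x + z)" if x: "x \<in> S" and z: "z \<in> S" for x z
  proof -
    define f where "f t x = q (x + scale t z) - t * q z" for t x
    have bdd: "bdd_below ((\<lambda>t. f t x) ` {0..})" if x: "x \<in> S" for x
    proof (rule bdd_belowI2)
      fix t :: real assume "t \<in> {0..}"
      then have t: "t \<ge> 0" by simp
      have tz: "scale t z \<in> S" using S z by (rule subspace_scale)
      have "t * q z = q ((x + scale t z) + - x)" using sublinear_onD(2)[OF q z t] by simp
      also have "\<dots> \<le> q (x + scale t z) + q (- x)"
        by (intro sublinear_onD(1)[OF q] subspace_add[OF S] subspace_neg[OF S] x tz)
      finally show "- q (- x) \<le> f t x" by (simp add: f_def)
    qed
    let ?r = "\<lambda>x. INF t\<in>{0..}. f t x"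
    have r: "sublinear_on S ?r"
    proof (rule sublinear_on_INF[OF S _ bdd])
      fix s t :: real and x y
      assume st: "s \<in> {0..}" "t \<in> {0..}" and xy: "x \<in> S" "y \<in> S"
      have "q ((x + scale s z) + (y + scale t z)) \<le> q (x + scale s z) + q (y + scale t z)"
        by (intro sublinear_onD(1)[OF q] subspace_add[OF S] subspace_scale[OF S] xy z)
      then have "f (s + t) (x + y) \<le> f s x + f t y"
        by (simp add: f_def algebra_simps scale_left_distrib)
      then show "\<exists>k\<in>{0..}. f k (x + y) \<le> f s x + f t y"
        using st by (intro bexI[of _ "s + t"]) auto
    next
      fix t c :: real and x
      assume t: "t \<in> {0..}" and x: "x \<in> S" and c: "0 < c"
      have "q (scale c (x + scale t z)) = c * q (x + scale t z)"
        using c by (intro sublinear_onD(2)[OF q] subspace_add[OF S] subspace_scale[OF S] x z) auto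
      then have "f (c * t) (scale c x) = c * f t x"
        by (simp add: f_def algebra_simps scale_right_distrib)
      then show "\<exists>k\<in>{0..}. f k (scale c x) \<le> c * f t x"
        using t c by (intro bexI[of _ "c * t"]) auto
    qed simp
    have "?r y \<le> q y" if "y \<in> S" for y
      using cINF_lower[OF bdd[OF that], of 0] by (simp add: f_def)
    then have "q x = ?r x" using min[OF r _ x] by simp
    also have "\<dots> \<le> f 1 x" using bdd[OF x] by (intro cINF_lower) auto
    finally show ?thesis by (simp add: f_def)
  qed
  show ?thesis
  proof (rule that[OF q le])
    fix x y assume xy: "x \<in> S" "y \<in> S"
    show "q (x + y) = q x + q y"
      by (rule antisym[OF sublinear_onD(1)[OF q xy] super[OF xy]])
  qed
qed

end

interpretation rv_real: real_space "scale_rv :: real \<Rightarrow> ('w \<Rightarrow> real) \<Rightarrow> 'w \<Rightarrow> real" ..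


section \<open>Gains of bounded random variables\<close>

lemma bounded_rvs_bdd_above: "X \<in> bounded_rvs \<Longrightarrow> bdd_above (range X)"
  by (simp add: bounded_rvs_def bounded_imp_bdd_above)

lemma subspace_bounded_rvs: "rv.subspace (bounded_rvs :: ('w \<Rightarrow> real) set)"
proof (rule rv.subspaceI)
  show "(0 :: 'w \<Rightarrow> real) \<in> bounded_rvs" by (auto simp: bounded_rvs_def zero_fun_def)
next
  fix X Y :: "'w \<Rightarrow> real" assume "X \<in> bounded_rvs" "Y \<in> bounded_rvs"
  then show "X + Y \<in> bounded_rvs"
    by (auto simp: bounded_rvs_def plus_fun_def intro: bounded_plus_comp)
next
  fix c and X :: "'w \<Rightarrow> real" assume "X \<in> bounded_rvs"
  then have "bounded ((\<lambda>x. c *\<^sub>R x) ` range X)"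
    unfolding bounded_rvs_def by (intro bounded_scaling) auto
  then show "scale_rv c X \<in> bounded_rvs"
    by (simp add: bounded_rvs_def scale_rv_def image_image)
qed

definition marginal_gain :: "(('w \<Rightarrow> real) \<Rightarrow> real) \<Rightarrow> ('w \<Rightarrow> real) \<Rightarrow> 'w \<Rightarrow> real" where
  "marginal_gain P X = (\<lambda>w. X w - P X)"

lemma marginal_gain_bounded: "X \<in> bounded_rvs \<Longrightarrow> marginal_gain P X \<in> bounded_rvs"
  using rv.subspace_diff[OF subspace_bounded_rvs, of X "\<lambda>_. P X"]
  by (simp add: marginal_gain_def fun_diff_def bounded_rvs_def)

lemma sum_marginal_gain_in_span:
  assumes "\<forall>i<(n::nat). X i \<in> D"
  shows "(\<lambda>w. \<Sum>i<n. s i * (X i w - P (X i))) \<in> rv.span (marginal_gain P ` D)"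
  using assms
proof (induction n)
  case 0
  then show ?case using rv.span_zero[of "marginal_gain P ` D"] by (simp add: zero_fun_def)
next
  case (Suc n)
  have "scale_rv (s n) (marginal_gain P (X n)) \<in> rv.span (marginal_gain P ` D)"
    using Suc.prems by (intro rv.span_scale rv.span_base) auto
  moreover have "(\<lambda>w. \<Sum>i<n. s i * (X i w - P (X i))) \<in> rv.span (marginal_gain P ` D)"
    using Suc by simp
  ultimately have "(\<lambda>w. \<Sum>i<n. s i * (X i w - P (X i))) + scale_rv (s n) (marginal_gain P (X n))
      \<in> rv.span (marginal_gain P ` D)"
    by (intro rv.span_add)
  also have "(\<lambda>w. \<Sum>i<n. s i * (X i w - P (X i))) + scale_rv (s n) (marginal_gain P (X n))
      = (\<lambda>w. \<Sum>i<Suc n. s i * (X i w - P (X i)))"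
    by (simp add: fun_eq_iff scale_rv_def marginal_gain_def)
  finally show ?case .
qed

text \<open>
  The signs in the definition only organise a linear combination with real coefficients: a term with
  nonnegative coefficient goes to the first family, a term with negative coefficient to the second.
\<close>

lemma span_marginal_gain_split:
  assumes "G \<in> rv.span (marginal_gain P ` D)"
  shows "\<exists>(n::nat) (m::nat) X Y s r. (\<forall>i<n. X i \<in> D \<and> s i \<ge> 0) \<and> (\<forall>j<m. Y j \<in> D \<and> r j \<ge> 0) \<and>
    G = (\<lambda>w. (\<Sum>i<n. s i * (X i w - P (X i))) - (\<Sum>j<m. r j * (Y j w - P (Y j))))"
  using assms
proof (induction rule: rv.span_induct_alt)
  case base
  show ?case by (intro exI[of _ "0::nat"]) (simp add: zero_fun_def)
next
  case (step c H G)
  then obtain n m :: nat and X Y s r Z where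
    XY: "\<forall>i<n. X i \<in> D \<and> s i \<ge> 0" "\<forall>j<m. Y j \<in> D \<and> r j \<ge> 0"
    and G: "G = (\<lambda>w. (\<Sum>i<n. s i * (X i w - P (X i))) - (\<Sum>j<m. r j * (Y j w - P (Y j))))"
    and Z: "Z \<in> D" "H = marginal_gain P Z"
    by blast
  show ?case
  proof (cases "c \<ge> 0")
    case True
    show ?thesis
      by (rule exI[of _ "Suc n"], rule exI[of _ m], rule exI[of _ "X(n := Z)"], rule exI[of _ Y],
          rule exI[of _ "s(n := c)"], rule exI[of _ r])
        (use True XY Z in \<open>auto simp: G plus_fun_def scale_rv_def marginal_gain_def less_Suc_eq\<close>)
  next
    case False
    show ?thesis
      by (rule exI[of _ n], rule exI[of _ "Suc m"], rule exI[of _ X], rule exI[of _ "Y(m := Z)"],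
          rule exI[of _ s], rule exI[of _ "r(m := - c)"])
        (use False XY Z in \<open>auto simp: G plus_fun_def scale_rv_def marginal_gain_def less_Suc_eq\<close>)
  qed
qed

lemma dF_coherent_iff_span:
  "dF_coherent D P \<longleftrightarrow> (\<forall>G \<in> rv.span (marginal_gain P ` D). (SUP w. G w) \<ge> 0)"
proof
  assume P: "dF_coherent D P"
  show "\<forall>G \<in> rv.span (marginal_gain P ` D). (SUP w. G w) \<ge> 0"
  proof
    fix G assume "G \<in> rv.span (marginal_gain P ` D)"
    then obtain n m :: nat and X Y s r where
      *: "(\<forall>i<n. X i \<in> D \<and> s i \<ge> 0) \<and> (\<forall>j<m. Y j \<in> D \<and> r j \<ge> 0)"
      and G: "G = (\<lambda>w. (\<Sum>i<n. s i * (X i w - P (X i))) - (\<Sum>j<m. r j * (Y j w - P (Y j))))"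
      using span_marginal_gain_split by blast
    show "(SUP w. G w) \<ge> 0"
      unfolding G by (rule P[unfolded dF_coherent_def, rule_format, OF *])
  qed
next
  assume *: "\<forall>G \<in> rv.span (marginal_gain P ` D). (SUP w. G w) \<ge> 0"
  show "dF_coherent D P"
    unfolding dF_coherent_def
  proof (intro allI impI)
    fix n m :: nat and X Y :: "nat \<Rightarrow> 'a \<Rightarrow> real" and s r :: "nat \<Rightarrow> real"
    assume "(\<forall>i<n. X i \<in> D \<and> s i \<ge> 0) \<and> (\<forall>j<m. Y j \<in> D \<and> r j \<ge> 0)"
    then have "(\<lambda>w. \<Sum>i<n. s i * (X i w - P (X i))) - (\<lambda>w. \<Sum>j<m. r j * (Y j w - P (Y j)))
        \<in> rv.span (marginal_gain P ` D)"
      by (intro rv.span_diff sum_marginal_gain_in_span) auto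
    with * show "(SUP w. (\<Sum>i<n. s i * (X i w - P (X i))) - (\<Sum>j<m. r j * (Y j w - P (Y j)))) \<ge> 0"
      by (force simp: fun_diff_def)
  qed
qed

lemma dF_coherent_subset:
  assumes "dF_coherent L Q" "D \<subseteq> L" "\<And>X. X \<in> D \<Longrightarrow> Q X = P X"
  shows "dF_coherent D P"
proof -
  have "marginal_gain P ` D \<subseteq> marginal_gain Q ` L"
    using assms(2,3) by (force simp: marginal_gain_def)
  then show ?thesis using assms(1) rv.span_mono unfolding dF_coherent_iff_span by blast
qed

lemma dF_coherent_imp_bi_coherent:
  assumes "dF_coherent D P"
  shows "bi_coherent D P"
  unfolding bi_coherent_def
proof (intro allI impI)
  fix n :: nat and X :: "nat \<Rightarrow> 'a \<Rightarrow> real" and s :: "nat \<Rightarrow> real" and Y1 Y2 and r1 r2 :: real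
  assume *: "(\<forall>i<n. X i \<in> D \<and> s i \<ge> 0) \<and> Y1 \<in> D \<and> Y2 \<in> D \<and> r1 \<ge> 0 \<and> r2 \<ge> 0"
  have "(\<lambda>w. \<Sum>i<n. s i * (X i w - P (X i)))
      - scale_rv r1 (marginal_gain P Y1) - scale_rv r2 (marginal_gain P Y2)
      \<in> rv.span (marginal_gain P ` D)"
    using * by (intro rv.span_diff rv.span_scale rv.span_base sum_marginal_gain_in_span) auto
  then show "(SUP w. (\<Sum>i<n. s i * (X i w - P (X i))) - r1 * (Y1 w - P Y1) - r2 * (Y2 w - P Y2)) \<ge> 0"
    using assms by (force simp: dF_coherent_iff_span fun_diff_def scale_rv_def marginal_gain_def)
qed


section \<open>Coherence on a linear space\<close>

lemma additive_on_zero_neg: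
  fixes Q :: "('w \<Rightarrow> real) \<Rightarrow> real"
  assumes L: "rv.subspace L"
    and add: "\<And>X Y. X \<in> L \<Longrightarrow> Y \<in> L \<Longrightarrow> Q (X + Y) = Q X + Q Y"
    and X: "X \<in> L"
  shows "Q 0 = 0" "Q (- X) = - Q X"
proof -
  show zero: "Q 0 = 0" using add[of 0 0] rv.subspace_0[OF L] by simp
  show "Q (- X) = - Q X" using add[OF X rv.subspace_neg[OF L X]] zero by simp
qed

text \<open>
  Linearity of \<open>Q\<close> makes \<open>Z - Q Z\<close> depend linearly on \<open>Z\<close>, so these gains already form a linear
  space and there is only one supremum to bound for each \<open>Z\<close>.
\<close>

lemma linear_dominated_imp_dF_coherent:
  fixes Q :: "('w \<Rightarrow> real) \<Rightarrow> real"
  assumes L: "rv.subspace L"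
    and add: "\<And>X Y. X \<in> L \<Longrightarrow> Y \<in> L \<Longrightarrow> Q (X + Y) = Q X + Q Y"
    and scale: "\<And>X c. X \<in> L \<Longrightarrow> 0 \<le> c \<Longrightarrow> Q (scale_rv c X) = c * Q X"
    and sup: "\<And>X. X \<in> L \<Longrightarrow> (SUP w. marginal_gain Q X w) \<ge> 0"
  shows "dF_coherent L Q"
proof -
  note neg = additive_on_zero_neg[where Q = Q, OF L add]
  have scale': "Q (scale_rv c X) = c * Q X" if X: "X \<in> L" for c X
  proof (cases "c \<ge> 0")
    case True
    then show ?thesis using scale[OF X] by simp
  next
    case False
    have "scale_rv c X = - scale_rv (- c) X" by simp
    then have "Q (scale_rv c X) = - Q (scale_rv (- c) X)"
      using neg(2)[OF _ _ rv.subspace_scale[OF L X, of "- c"]] by simp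
    also have "\<dots> = c * Q X" using scale[OF X, of "- c"] False by simp
    finally show ?thesis .
  qed
  have "rv.subspace (marginal_gain Q ` L)"
  proof (rule rv.subspaceI)
    have "marginal_gain Q 0 = 0"
      using neg(1)[OF _ _ rv.subspace_0[OF L]] by (simp add: marginal_gain_def fun_eq_iff)
    then show "0 \<in> marginal_gain Q ` L" using rv.subspace_0[OF L] by (metis imageI)
  next
    fix G H assume "G \<in> marginal_gain Q ` L" "H \<in> marginal_gain Q ` L"
    then obtain X Y where X: "X \<in> L" and Y: "Y \<in> L"
      and GH: "G = marginal_gain Q X" "H = marginal_gain Q Y" by blast
    have "G + H = marginal_gain Q (X + Y)"
      by (simp add: GH marginal_gain_def fun_eq_iff add[OF X Y])
    then show "G + H \<in> marginal_gain Q ` L" using rv.subspace_add[OF L X Y] by simp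
  next
    fix c G assume "G \<in> marginal_gain Q ` L"
    then obtain X where X: "X \<in> L" and G: "G = marginal_gain Q X" by blast
    have "scale_rv c G = marginal_gain Q (scale_rv c X)"
      by (simp add: G marginal_gain_def scale'[OF X])
        (simp add: scale_rv_def algebra_simps)
    then show "scale_rv c G \<in> marginal_gain Q ` L" using rv.subspace_scale[OF L X] by simp
  qed
  then have span: "rv.span (marginal_gain Q ` L) = marginal_gain Q ` L" by simp
  show ?thesis unfolding dF_coherent_iff_span span using sup by blast
qed

text \<open>
  Additivity on a pair compares two random variables with their sum in both directions, hence needs
  two summands on either side of the gain; coefficient \<open>0\<close> covers the shorter gains.
\<close>

lemma bi_coherent_two_two:
  assumes "bi_coherent D P" "X1 \<in> D" "X2 \<in> D" "Y1 \<in> D" "Y2 \<in> D"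
    and "s1 \<ge> 0" "s2 \<ge> 0" "r1 \<ge> 0" "r2 \<ge> 0"
  shows "(SUP w. s1 * (X1 w - P X1) + s2 * (X2 w - P X2)
            - r1 * (Y1 w - P Y1) - r2 * (Y2 w - P Y2)) \<ge> 0"
  using assms(1)[unfolded bi_coherent_def, rule_format, of 2 "\<lambda>i. if i = 0 then X1 else X2"
      "\<lambda>i. if i = 0 then s1 else s2" Y1 Y2 r1 r2] assms(2-)
  by (simp add: numeral_2_eq_2)

text \<open>
  The gains chosen for additivity and homogeneity are those in which the random parts cancel. The
  supremum of the remaining constant is that constant, so each of them gives one inequality between
  values of \<open>Q\<close>, and the gain with opposite signs gives the reverse one.
\<close>

theorem bi_coherent_imp_dF_coherent:
  fixes Q :: "('w \<Rightarrow> real) \<Rightarrow> real"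
  assumes L: "rv.subspace L" and Q: "bi_coherent L Q"
  shows "dF_coherent L Q"
proof (rule linear_dominated_imp_dF_coherent[where Q = Q, OF L])
  fix X Y assume X: "X \<in> L" and Y: "Y \<in> L"
  note XY = rv.subspace_add[OF L X Y]
  show "Q (X + Y) = Q X + Q Y"
    using bi_coherent_two_two[OF Q X Y XY XY, of 1 1 1 0]
      bi_coherent_two_two[OF Q XY XY X Y, of 1 0 1 1]
    by simp
next
  fix X and c :: real assume X: "X \<in> L" and c: "0 \<le> c"
  note cX = rv.subspace_scale[OF L X, of c]
  show "Q (scale_rv c X) = c * Q X"
    using bi_coherent_two_two[OF Q X X cX cX, of c 0 1 0]
      bi_coherent_two_two[OF Q cX cX X X, of 1 0 c 0] c
    by (simp add: scale_rv_def algebra_simps)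
next
  fix X assume X: "X \<in> L"
  show "(SUP w. marginal_gain Q X w) \<ge> 0"
    using bi_coherent_two_two[OF Q X X X X, of 1 0 0 0] by (simp add: marginal_gain_def)
qed


section \<open>Extension of a dF-coherent prevision\<close>

text \<open>
  The space \<open>V\<close> of gains need not lie in \<open>L\<close>, because \<open>L\<close> need not contain the constants. The
  functional \<open>p\<close> is finite because \<open>sup (Z - G) \<ge> inf Z + sup (- G) \<ge> inf Z\<close>, where the second step
  is dF-coherence applied to \<open>- G \<in> V\<close>.
\<close>

theorem dF_coherent_extension:
  fixes D L :: "('w \<Rightarrow> real) set"
  assumes P: "dF_coherent D P" and L: "rv.subspace L" "L \<subseteq> bounded_rvs" and D: "D \<subseteq> L"
  obtains Q where "dF_coherent L Q" "\<And>X. X \<in> D \<Longrightarrow> Q X = P X"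
proof -
  define V where "V = rv.span (marginal_gain P ` D)"
  have V: "rv.subspace V" unfolding V_def by (rule rv.subspace_span)
  have V_bounded: "V \<subseteq> bounded_rvs"
    unfolding V_def using D L(2)
    by (intro rv.span_minimal subspace_bounded_rvs) (auto intro: marginal_gain_bounded)
  have V_sup: "(SUP w. G w) \<ge> 0" if "G \<in> V" for G
    using P that by (simp add: V_def dF_coherent_iff_span)
  have diff_bdd: "bdd_above (range (\<lambda>w. Z w - G w))" if "Z \<in> L" "G \<in> V" for Z G
  proof -
    have "Z - G \<in> bounded_rvs"
      using that L(2) V_bounded by (intro rv.subspace_diff[OF subspace_bounded_rvs]) auto
    then show ?thesis by (simp add: bounded_rvs_bdd_above fun_diff_def)
  qed
  have upper: "Z w - G w \<le> (SUP w. Z w - G w)" if "Z \<in> L" "G \<in> V" for Z G w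
    using diff_bdd[OF that] by (intro cSUP_upper) auto
  define p where "p Z = (INF G\<in>V. SUP w. Z w - G w)" for Z
  have below: "bdd_below ((\<lambda>G. SUP w. Z w - G w) ` V)" if Z: "Z \<in> L" for Z
  proof (rule bdd_belowI2)
    fix G assume G: "G \<in> V"
    have "- Z \<in> bounded_rvs" using rv.subspace_neg[OF L(1) Z] L(2) by blast
    then have "- Z w \<le> (SUP w. - Z w)" for w
      using cSUP_upper[of w UNIV "- Z"] bounded_rvs_bdd_above[of "- Z"] by simp
    then have "- G w \<le> (SUP w. - Z w) + (SUP w. Z w - G w)" for w
      using upper[OF Z G, of w] by (smt (verit))
    then have "(SUP w. - G w) \<le> (SUP w. - Z w) + (SUP w. Z w - G w)"
      by (intro cSUP_least) auto
    moreover have "(SUP w. - G w) \<ge> 0"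
      using V_sup[OF rv.subspace_neg[OF V G]] by simp
    ultimately show "- (SUP w. - Z w) \<le> (SUP w. Z w - G w)" by simp
  qed
  have p_le: "p Z \<le> (SUP w. Z w - G w)" if "Z \<in> L" "G \<in> V" for Z G
    unfolding p_def using below that by (intro cINF_lower) auto
  have "rv_real.sublinear_on L p"
    unfolding p_def
  proof (rule rv_real.sublinear_on_INF[OF L(1) _ below])
    show "V \<noteq> {}" using rv.subspace_0[OF V] by blast
  next
    fix G H X Y assume *: "G \<in> V" "H \<in> V" "X \<in> L" "Y \<in> L"
    have "(SUP w. (X + Y) w - (G + H) w) \<le> (SUP w. X w - G w) + (SUP w. Y w - H w)"
      using upper * by (intro cSUP_least) (auto simp: add_diff_add intro!: add_mono)
    then show "\<exists>K\<in>V. (SUP w. (X + Y) w - K w) \<le> (SUP w. X w - G w) + (SUP w. Y w - H w)"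
      using rv.subspace_add[OF V] * by blast
  next
    fix G X and c :: real assume *: "G \<in> V" "X \<in> L" "0 < c"
    have "(SUP w. scale_rv c X w - scale_rv c G w) \<le> c * (SUP w. X w - G w)"
      using upper * by (intro cSUP_least)
        (auto simp: scale_rv_def right_diff_distrib[symmetric] intro!: mult_left_mono)
    then show "\<exists>K\<in>V. (SUP w. scale_rv c X w - K w) \<le> c * (SUP w. X w - G w)"
      using rv.subspace_scale[OF V] * by blast
  qed
  from rv_real.sublinear_dominates_additive[OF L(1) this]
  obtain Q where Q: "rv_real.sublinear_on L Q" and Q_le: "\<And>X. X \<in> L \<Longrightarrow> Q X \<le> p X"
    and Q_add: "\<And>X Y. X \<in> L \<Longrightarrow> Y \<in> L \<Longrightarrow> Q (X + Y) = Q X + Q Y"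
    by metis
  show ?thesis
  proof (rule that[of Q])
    show "dF_coherent L Q"
    proof (rule linear_dominated_imp_dF_coherent[where Q = Q, OF L(1) Q_add])
      fix X and c :: real assume "X \<in> L" "0 \<le> c"
      then show "Q (scale_rv c X) = c * Q X" by (rule rv_real.sublinear_onD(2)[OF Q])
    next
      fix X assume X: "X \<in> L"
      have "Q X \<le> (SUP w. X w)"
        using Q_le[OF X] p_le[OF X rv.subspace_0[OF V]] by simp
      also have "\<dots> \<le> (SUP w. marginal_gain Q X w) + Q X"
      proof (rule cSUP_least)
        fix w
        have "marginal_gain Q X w \<le> (SUP w. marginal_gain Q X w)"
          using X L(2) by (intro cSUP_upper bounded_rvs_bdd_above marginal_gain_bounded) auto
        then show "X w \<le> (SUP w. marginal_gain Q X w) + Q X" by (simp add: marginal_gain_def)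
      qed simp
      finally show "(SUP w. marginal_gain Q X w) \<ge> 0" by simp
    qed
  next
    fix X assume "X \<in> D"
    then have X: "X \<in> L" and G: "marginal_gain P X \<in> V"
      using D by (auto simp: V_def intro: rv.span_base)
    have "Q X \<le> P X"
      using Q_le[OF X] p_le[OF X G] by (simp add: marginal_gain_def)
    moreover have "Q (- X) \<le> - P X"
      using Q_le[OF rv.subspace_neg[OF L(1) X]]
        p_le[OF rv.subspace_neg[OF L(1) X] rv.subspace_neg[OF V G]]
      by (simp add: marginal_gain_def)
    ultimately show "Q X = P X"
      using additive_on_zero_neg(2)[where Q = Q, OF L(1) Q_add X] by simp
  qed
qed

theorem corollary2:
  fixes D L :: "('w \<Rightarrow> real) set"
    and P :: "('w \<Rightarrow> real) \<Rightarrow> real"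
  assumes "D \<noteq> {}"
    and "D \<subseteq> bounded_rvs"
    and "bi_coherent D P"
    and "rv.subspace L"
    and "L \<subseteq> bounded_rvs"
    and "D \<subseteq> L"
  shows "(\<exists>Q. bi_coherent L Q \<and> (\<forall>X\<in>D. Q X = P X)) \<longleftrightarrow> dF_coherent D P"
proof
  assume "\<exists>Q. bi_coherent L Q \<and> (\<forall>X\<in>D. Q X = P X)"
  then show "dF_coherent D P"
    using bi_coherent_imp_dF_coherent[OF assms(4)] dF_coherent_subset[OF _ assms(6)] by blast
next
  assume "dF_coherent D P"
  then obtain Q where "dF_coherent L Q" "\<And>X. X \<in> D \<Longrightarrow> Q X = P X"
    using dF_coherent_extension assms(4-6) by blast
  then show "\<exists>Q. bi_coherent L Q \<and> (\<forall>X\<in>D. Q X = P X)"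
    using dF_coherent_imp_bi_coherent by blast
qed

end
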